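(* Let $L$ be a complete, meet-continuous modular lattice, and let $x\prec y$ be a covering in $L$ which is regular in $L$. Then the covering $\mathrm{Fg}\{x\}\prec\mathrm{Fg}\{y\}$ is regular in the lattice of filters $\mathrm{Fil}\,L$.
   Context: A covering $x\prec y$ in a lattice is a pair $x<y$ with no element strictly between. For pairs with $x\le y$, $z\le w$, write $\langle x,y\rangle\nearrow\langle z,w\rangle$ if $y\wedge z=x$ and $y\vee z=w$; projective equivalence $\sim$ is the symmetric and transitive closure of $\nearrow$. A complete lattice $L$ is meet-continuous if $a\wedge\bigvee D=\bigvee_{d\in D}(a\wedge d)$ for all $a\in L$ and all upward directed $D\subseteq L$. A covering $x\prec y$ in a complete modular lattice is upper regular if for every nonempty chain (totally ordered set) $I$ and every family of coverings $x_i\prec y_i$ ($i\in I$), each projectively equivalent to $x\prec y$ and such that $i<j$ implies $\langle x_i,y_i\rangle\nearrow\langle x_j,y_j\rangle$, we have $\bigvee_i x_i\prec\bigvee_i y_i$ (in a modular lattice the only other possibility is equality). Lower regular is the dual property. Regular means both upper regular and lower regular. A filter of $L$ is a nonempty up-closed subset closed under binary meets. $\mathrm{Fil}\,L$ is the set of filters ordered by reverse inclusion: $F\le G$ iff $G\subseteq F$. It is a lattice with $F\vee G=F\cap G$, complete if $L$ has a greatest element, and modular if $L$ is modular. $\mathrm{Fg}\{x\}=\{z\in L: z\ge x\}$ is the principal filter; $x\mapsto\mathrm{Fg}\{x\}$ is a lattice embedding $L\to\mathrm{Fil}\,L$ and $x\prec y$ in $L$ implies $\mathrm{Fg}\{x\}\prec\mathrm{Fg}\{y\}$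 in $\mathrm{Fil}\,L$ when $L$ is modular. *)

theory Defs
  imports "HOL-Library.Dual_Ordered_Lattice"
begin

unbundle lattice_syntax

section \<open>Modular and meet-continuous lattices\<close>

class modular_lattice = lattice +
  assumes modular: "x \<le> z \<Longrightarrow> x \<squnion> (y \<sqinter> z) = (x \<squnion> y) \<sqinter> z"

class complete_modular_lattice = complete_lattice + modular_lattice

definition (in order) up_directed :: "'a set \<Rightarrow> bool" where
  "up_directed D \<longleftrightarrow> D \<noteq> {} \<and> (\<forall>d\<in>D. \<forall>e\<in>D. \<exists>f\<in>D. d \<le> f \<and> e \<le> f)"

class meet_continuous_lattice = complete_lattice +
  assumes meet_continuous: "up_directed D \<Longrightarrow> a \<sqinter> \<Squnion>D = (\<Squnion>d\<in>D. a \<sqinter> d)"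

instance dual :: (modular_lattice) modular_lattice
proof
  fix x y z :: "'a dual"
  assume "x \<le> z"
  then have "undual z \<le> undual x" by (simp only: dual_less_eq_iff)
  from modular[OF this, of "undual y"] show "x \<squnion> (y \<sqinter> z) = (x \<squnion> y) \<sqinter> z"
    by (simp add: dual_eq_iff inf_commute sup_commute)
qed

instance dual :: (complete_modular_lattice) complete_modular_lattice ..


section \<open>Coverings, projectivity, regularity\<close>

definition covering :: "'a::order \<Rightarrow> 'a \<Rightarrow> bool" (infix "\<prec>" 50) where
  "x \<prec> y \<longleftrightarrow> x < y \<and> \<not> (\<exists>z. x < z \<and> z < y)"

definition transposes_up :: "'a::lattice \<times> 'a \<Rightarrow> 'a \<times> 'a \<Rightarrow> bool" (infix "\<nearrow>" 50) where
  "p \<nearrow> q \<longleftrightarrow> (case (p, q) of ((x, y), (z, w)) \<Rightarrow>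
     x \<le> y \<and> z \<le> w \<and> y \<sqinter> z = x \<and> y \<squnion> z = w)"

definition proj_equiv :: "'a::lattice \<times> 'a \<Rightarrow> 'a \<times> 'a \<Rightarrow> bool" where
  "proj_equiv = (symclp (\<nearrow>))\<^sup>+\<^sup>+"

text \<open>
  A chain of coverings is a family indexed by a totally ordered set. In the definitions below the
  index set \<^term>\<open>I\<close> lives in the type \<^typ>\<open>'a \<times> 'a\<close>, because a definition cannot quantify over
  types. This is no restriction: the lemmas \<open>upper_regularD\<close> and \<open>lower_regularD\<close> give the
  property for totally ordered index sets of an arbitrary type.
\<close>

definition upper_regular :: "'a::complete_lattice \<Rightarrow> 'a \<Rightarrow> bool" where
  "upper_regular x y \<longleftrightarrow>
    (\<forall>(I :: ('a \<times> 'a) set) r u v.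
       I \<noteq> {} \<and> linear_order_on I r \<and>
       (\<forall>i\<in>I. u i \<prec> v i \<and> proj_equiv (u i, v i) (x, y)) \<and>
       (\<forall>i\<in>I. \<forall>j\<in>I. (i, j) \<in> r \<and> i \<noteq> j \<longrightarrow> (u i, v i) \<nearrow> (u j, v j))
       \<longrightarrow> (\<Squnion>i\<in>I. u i) \<prec> (\<Squnion>i\<in>I. v i))"

text \<open>
  Dualizing the lattice turns \<open>(u i, v i) \<nearrow> (u j, v j)\<close> into \<open>(u j, v j) \<nearrow> (u i, v i)\<close>;
  see \<open>lower_regular_iff_dual\<close> below.
\<close>

definition lower_regular :: "'a::complete_lattice \<Rightarrow> 'a \<Rightarrow> bool" where
  "lower_regular x y \<longleftrightarrow>
    (\<forall>(I :: ('a \<times> 'a) set) r u v.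
       I \<noteq> {} \<and> linear_order_on I r \<and>
       (\<forall>i\<in>I. u i \<prec> v i \<and> proj_equiv (u i, v i) (x, y)) \<and>
       (\<forall>i\<in>I. \<forall>j\<in>I. (i, j) \<in> r \<and> i \<noteq> j \<longrightarrow> (u j, v j) \<nearrow> (u i, v i))
       \<longrightarrow> (\<Sqinter>i\<in>I. u i) \<prec> (\<Sqinter>i\<in>I. v i))"

definition regular :: "'a::complete_lattice \<Rightarrow> 'a \<Rightarrow> bool" where
  "regular x y \<longleftrightarrow> upper_regular x y \<and> lower_regular x y"

lemma transposes_up_refl: "x \<le> y \<Longrightarrow> (x, y) \<nearrow> (x, y)"
  by (simp add: transposes_up_def inf_absorb2 sup_absorb1)

lemma transposes_up_mono: "(x, y) \<nearrow> (z, w) \<Longrightarrow> x \<le> z \<and> y \<le> w"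
  by (auto simp: transposes_up_def)

lemma chain_image_linear_order:
  assumes r: "linear_order_on I r"
    and le: "\<And>i. i \<in> I \<Longrightarrow> u i \<le> v i"
    and tr: "\<And>i j. i \<in> I \<Longrightarrow> j \<in> I \<Longrightarrow> (i, j) \<in> r \<Longrightarrow> i \<noteq> j \<Longrightarrow> (u i, v i) \<nearrow> (u j, v j)"
  defines "C \<equiv> (\<lambda>i. (u i, v i)) ` I"
  shows "linear_order_on C {(p, q) \<in> C \<times> C. p \<nearrow> q}"
proof -
  have refl: "p \<nearrow> p" if "p \<in> C" for p
    using that le by (auto simp: C_def transposes_up_refl)
  have anti: "p = q" if "p \<nearrow> q" "q \<nearrow> p" for p q :: "'b \<times> 'b"
    using that by (cases p; cases q) (auto dest!: transposes_up_mono)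
  have total: "p \<nearrow> q \<or> q \<nearrow> p" if pq: "p \<in> C" "q \<in> C" for p q
  proof -
    obtain i j where ij: "i \<in> I" "j \<in> I" "p = (u i, v i)" "q = (u j, v j)"
      using pq by (auto simp: C_def)
    then show ?thesis
    proof (cases "i = j")
      case True
      then show ?thesis using refl pq ij by auto
    next
      case False
      then have "(i, j) \<in> r \<or> (j, i) \<in> r"
        using r ij by (auto simp: linear_order_on_def total_on_def)
      then show ?thesis using tr ij False by metis
    qed
  qed
  have trans: "p \<nearrow> s" if "p \<in> C" "q \<in> C" "s \<in> C" "p \<nearrow> q" "q \<nearrow> s" for p q s
  proof -
    have "p = s" if "s \<nearrow> p"
      using \<open>p \<nearrow> q\<close> \<open>q \<nearrow> s\<close> that
      by (cases p; cases q; cases s) (auto dest!: transposes_up_mono)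
    then show ?thesis using total[of p s] that by blast
  qed
  let ?R = "{(p, q) \<in> C \<times> C. p \<nearrow> q}"
  have "refl_on C ?R" "?R \<subseteq> C \<times> C"
    using refl by (auto simp only: refl_on_def)
  moreover have "trans ?R" by (rule transI) (use trans in blast)
  moreover have "antisym ?R" by (rule antisymI) (use anti in blast)
  moreover have "total_on C ?R" unfolding total_on_def using total by blast
  ultimately show ?thesis unfolding order_on_defs by blast
qed

lemma upper_regularD:
  fixes I :: "'i set" and u v :: "'i \<Rightarrow> 'a::complete_lattice"
  assumes reg: "upper_regular x y" and ne: "I \<noteq> {}" and r: "linear_order_on I r"
    and cov: "\<And>i. i \<in> I \<Longrightarrow> u i \<prec> v i"
    and proj: "\<And>i. i \<in> I \<Longrightarrow> proj_equiv (u i, v i) (x, y)"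
    and tr: "\<And>i j. i \<in> I \<Longrightarrow> j \<in> I \<Longrightarrow> (i, j) \<in> r \<Longrightarrow> i \<noteq> j \<Longrightarrow> (u i, v i) \<nearrow> (u j, v j)"
  shows "(\<Squnion>i\<in>I. u i) \<prec> (\<Squnion>i\<in>I. v i)"
proof -
  let ?C = "(\<lambda>i. (u i, v i)) ` I"
  have lin: "linear_order_on ?C {(p, q) \<in> ?C \<times> ?C. p \<nearrow> q}"
    using chain_image_linear_order[OF r _ tr] cov by (auto simp: covering_def less_imp_le)
  have "(\<Squnion>p\<in>?C. fst p) \<prec> (\<Squnion>p\<in>?C. snd p)"
    by (rule reg[unfolded upper_regular_def, rule_format,
          where r = "{(p, q) \<in> ?C \<times> ?C. p \<nearrow> q}"], intro conjI ballI impI)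
       (use ne lin cov proj in auto)
  then show ?thesis by (simp add: image_image)
qed

lemma lower_regularD:
  fixes I :: "'i set" and u v :: "'i \<Rightarrow> 'a::complete_lattice"
  assumes reg: "lower_regular x y" and ne: "I \<noteq> {}" and r: "linear_order_on I r"
    and cov: "\<And>i. i \<in> I \<Longrightarrow> u i \<prec> v i"
    and proj: "\<And>i. i \<in> I \<Longrightarrow> proj_equiv (u i, v i) (x, y)"
    and tr: "\<And>i j. i \<in> I \<Longrightarrow> j \<in> I \<Longrightarrow> (i, j) \<in> r \<Longrightarrow> i \<noteq> j \<Longrightarrow> (u j, v j) \<nearrow> (u i, v i)"
  shows "(\<Sqinter>i\<in>I. u i) \<prec> (\<Sqinter>i\<in>I. v i)"
proof -
  let ?C = "(\<lambda>i. (u i, v i)) ` I"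
  let ?R = "{(p, q) \<in> ?C \<times> ?C. p \<nearrow> q}"
  have "linear_order_on I (r\<inverse>)" using r by simp
  then have "linear_order_on ?C ?R"
    by (rule chain_image_linear_order) (use cov tr in \<open>auto simp: covering_def less_imp_le\<close>)
  then have lin: "linear_order_on ?C (?R\<inverse>)" by simp
  have "(\<Sqinter>p\<in>?C. fst p) \<prec> (\<Sqinter>p\<in>?C. snd p)"
    by (rule reg[unfolded lower_regular_def, rule_format, where r = "?R\<inverse>"],
        intro conjI ballI impI)
       (use ne lin cov proj in auto)
  then show ?thesis by (simp add: image_image)
qed

lemma covering_dual: "dual y \<prec> dual x \<longleftrightarrow> x \<prec> y"
proof -
  have "(\<exists>z. dual y < z \<and> z < dual x) \<longleftrightarrow> (\<exists>z. x < z \<and> z < y)"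
    by (metis dual_less_iff undual_dual dual_undual)
  then show ?thesis by (auto simp: covering_def dual_less_iff)
qed

lemma transposes_up_dual: "(dual y, dual x) \<nearrow> (dual w, dual z) \<longleftrightarrow> (z, w) \<nearrow> (x, y)"
proof -
  have "(dual y, dual x) \<nearrow> (dual w, dual z) \<longleftrightarrow>
      x \<le> y \<and> z \<le> w \<and> x \<squnion> w = y \<and> x \<sqinter> w = z"
    by (simp add: transposes_up_def dual_less_eq_iff
        flip: dual_sup_eq dual_inf_eq)
  then show ?thesis
    by (auto simp: transposes_up_def sup_commute inf_commute)
qed

lemma proj_equiv_dual: "proj_equiv (dual y, dual x) (dual w, dual z) \<longleftrightarrow> proj_equiv (x, y) (z, w)"
proof
  let ?f = "\<lambda>(x, y). (dual y, dual x)" and ?g = "\<lambda>(x, y). (undual y, undual x)"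
  have f: "?f p \<nearrow> ?f q \<longleftrightarrow> q \<nearrow> p" for p q :: "'a \<times> 'a"
    by (cases p; cases q) (simp add: transposes_up_dual)
  have g: "?g p \<nearrow> ?g q \<longleftrightarrow> q \<nearrow> p" for p q :: "'a dual \<times> 'a dual"
    using f[of "?g q" "?g p"] by (cases p; cases q) simp
  show "proj_equiv (dual y, dual x) (dual w, dual z)" if "proj_equiv (x, y) (z, w)"
  proof -
    have "(symclp (\<nearrow>))\<^sup>+\<^sup>+ (?f p) (?f q)" if "(symclp (\<nearrow>))\<^sup>+\<^sup>+ p q" for p q :: "'a \<times> 'a"
      using that
    proof induction
      case (base q)
      then show ?case by (intro tranclp.r_into_trancl) (auto simp: symclp_def f simp del: split_paired_All)
    next
      case (step q s)
      then have "symclp (\<nearrow>) (?f q) (?f s)" by (simp only: symclp_def f) blast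
      with step show ?case by (meson tranclp.trancl_into_trancl)
    qed
    from this[of "(x, y)" "(z, w)"] that show ?thesis by (simp add: proj_equiv_def)
  qed
  show "proj_equiv (x, y) (z, w)" if "proj_equiv (dual y, dual x) (dual w, dual z)"
  proof -
    have "(symclp (\<nearrow>))\<^sup>+\<^sup>+ (?g p) (?g q)" if "(symclp (\<nearrow>))\<^sup>+\<^sup>+ p q" for p q :: "'a dual \<times> 'a dual"
      using that
    proof induction
      case (base q)
      then show ?case by (intro tranclp.r_into_trancl) (simp only: symclp_def g, blast)
    next
      case (step q s)
      then have "symclp (\<nearrow>) (?g q) (?g s)" by (simp only: symclp_def g) blast
      with step show ?case by (meson tranclp.trancl_into_trancl)
    qed
    from this[of "(dual y, dual x)" "(dual w, dual z)"] that show ?thesis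
      by (simp add: proj_equiv_def)
  qed
qed

lemma lower_regular_iff_dual: "lower_regular x y \<longleftrightarrow> upper_regular (dual y) (dual x)"
proof
  assume reg: "lower_regular x y"
  show "upper_regular (dual y) (dual x)"
    unfolding upper_regular_def
  proof (intro allI impI, elim conjE)
    fix I :: "('a dual \<times> 'a dual) set" and r u v
    assume I: "I \<noteq> {}" "linear_order_on I r"
      and cov: "\<forall>i\<in>I. u i \<prec> v i \<and> proj_equiv (u i, v i) (dual y, dual x)"
      and tr: "\<forall>i\<in>I. \<forall>j\<in>I. (i, j) \<in> r \<and> i \<noteq> j \<longrightarrow> (u i, v i) \<nearrow> (u j, v j)"
    have "(\<Sqinter>i\<in>I. undual (v i)) \<prec> (\<Sqinter>i\<in>I. undual (u i))"
    proof (rule lower_regularD[OF reg I])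
      fix i assume i: "i \<in> I"
      show "undual (v i) \<prec> undual (u i)"
        using cov i covering_dual[of "undual (u i)" "undual (v i)"] by simp
      show "proj_equiv (undual (v i), undual (u i)) (x, y)"
        using cov i proj_equiv_dual[of "undual (u i)" "undual (v i)" y x] by simp
    next
      fix i j assume "i \<in> I" "j \<in> I" "(i, j) \<in> r" "i \<noteq> j"
      then show "(undual (v j), undual (u j)) \<nearrow> (undual (v i), undual (u i))"
        using tr transposes_up_dual[of "undual (u i)" "undual (v i)" "undual (u j)" "undual (v j)"]
        by simp
    qed
    then have "dual (\<Sqinter>i\<in>I. undual (u i)) \<prec> dual (\<Sqinter>i\<in>I. undual (v i))"
      by (simp only: covering_dual)
    then show "(\<Squnion>i\<in>I. u i) \<prec> (\<Squnion>i\<in>I. v i)"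
      by (simp add: image_image)
  qed
next
  assume reg: "upper_regular (dual y) (dual x)"
  show "lower_regular x y"
    unfolding lower_regular_def
  proof (intro allI impI, elim conjE)
    fix I :: "('a \<times> 'a) set" and r u v
    assume I: "I \<noteq> {}" "linear_order_on I r"
      and cov: "\<forall>i\<in>I. u i \<prec> v i \<and> proj_equiv (u i, v i) (x, y)"
      and tr: "\<forall>i\<in>I. \<forall>j\<in>I. (i, j) \<in> r \<and> i \<noteq> j \<longrightarrow> (u j, v j) \<nearrow> (u i, v i)"
    have "(\<Squnion>i\<in>I. dual (v i)) \<prec> (\<Squnion>i\<in>I. dual (u i))"
      by (rule upper_regularD[OF reg I])
         (use cov tr in \<open>auto simp: covering_dual proj_equiv_dual transposes_up_dual\<close>)
    then have "dual (\<Sqinter>i\<in>I. v i) \<prec> dual (\<Sqinter>i\<in>I. u i)"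
      by (simp add: image_image)
    then show "(\<Sqinter>i\<in>I. u i) \<prec> (\<Sqinter>i\<in>I. v i)"
      by (simp only: covering_dual)
  qed
qed


section \<open>The lattice of filters\<close>

definition lattice_filter :: "'a::lattice set \<Rightarrow> bool" where
  "lattice_filter F \<longleftrightarrow> F \<noteq> {} \<and> (\<forall>a\<in>F. \<forall>b. a \<le> b \<longrightarrow> b \<in> F) \<and> (\<forall>a\<in>F. \<forall>b\<in>F. a \<sqinter> b \<in> F)"

typedef (overloaded) 'a fil = "{F :: 'a::lattice set. lattice_filter F}"
  morphisms elems Abs_fil
  by (rule exI[of _ UNIV]) (simp add: lattice_filter_def)

setup_lifting type_definition_fil

lift_definition Fg :: "'a::lattice \<Rightarrow> 'a fil" is "\<lambda>x. {z. x \<le> z}"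
  by (auto simp: lattice_filter_def)

instantiation fil :: (lattice) lattice
begin

lift_definition less_eq_fil :: "'a fil \<Rightarrow> 'a fil \<Rightarrow> bool" is "\<lambda>F G. G \<subseteq> F" .

lift_definition less_fil :: "'a fil \<Rightarrow> 'a fil \<Rightarrow> bool" is "\<lambda>F G. G \<subset> F" .

lift_definition sup_fil :: "'a fil \<Rightarrow> 'a fil \<Rightarrow> 'a fil" is "\<lambda>F G. F \<inter> G"
proof -
  fix F G :: "'a set"
  assume F: "lattice_filter F" and G: "lattice_filter G"
  then obtain a b where "a \<in> F" "b \<in> G" by (auto simp: lattice_filter_def)
  then have "a \<squnion> b \<in> F \<inter> G"
    using F G unfolding lattice_filter_def by (meson IntI sup_ge1 sup_ge2)
  then show "lattice_filter (F \<inter> G)"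
    using F G by (auto simp: lattice_filter_def)
qed

lift_definition inf_fil :: "'a fil \<Rightarrow> 'a fil \<Rightarrow> 'a fil" is
  "\<lambda>F G. {c. \<exists>a\<in>F. \<exists>b\<in>G. a \<sqinter> b \<le> c}"
proof -
  fix F G :: "'a set"
  assume F: "lattice_filter F" and G: "lattice_filter G"
  let ?H = "{c. \<exists>a\<in>F. \<exists>b\<in>G. a \<sqinter> b \<le> c}"
  have "c \<sqinter> d \<in> ?H" if "c \<in> ?H" "d \<in> ?H" for c d
  proof -
    obtain a b a' b' where "a \<in> F" "b \<in> G" "a \<sqinter> b \<le> c" "a' \<in> F" "b' \<in> G" "a' \<sqinter> b' \<le> d"
      using \<open>c \<in> ?H\<close> \<open>d \<in> ?H\<close> by blast
    moreover from this have "(a \<sqinter> a') \<sqinter> (b \<sqinter> b') \<le> c \<sqinter> d"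
      by (metis inf_mono inf_assoc inf_left_commute)
    moreover have "a \<sqinter> a' \<in> F" "b \<sqinter> b' \<in> G"
      using calculation F G by (auto simp: lattice_filter_def)
    ultimately show ?thesis by blast
  qed
  moreover have "?H \<noteq> {}"
  proof -
    obtain a b where "a \<in> F" "b \<in> G" using F G by (auto simp: lattice_filter_def)
    then have "a \<sqinter> b \<in> ?H" by blast
    then show ?thesis by blast
  qed
  moreover have "d \<in> ?H" if "c \<in> ?H" "c \<le> d" for c d
    using that order_trans by blast
  ultimately show "lattice_filter ?H" unfolding lattice_filter_def by blast
qed

instance
proof
  fix F G H :: "'a fil"
  show "F < G \<longleftrightarrow> F \<le> G \<and> \<not> G \<le> F" by transfer auto
  show "F \<le> F" by transfer auto
  show "F \<le> H" if "F \<le> G" "G \<le> H" using that by transfer auto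
  show "F = G" if "F \<le> G" "G \<le> F" using that by transfer auto
  show "F \<sqinter> G \<le> F"
  proof transfer
    fix F G :: "'a set"
    assume "lattice_filter G"
    then obtain b where "b \<in> G" by (auto simp: lattice_filter_def)
    then show "F \<subseteq> {c. \<exists>a\<in>F. \<exists>b\<in>G. a \<sqinter> b \<le> c}" using inf_le1 by blast
  qed
  show "F \<sqinter> G \<le> G"
  proof transfer
    fix F G :: "'a set"
    assume "lattice_filter F"
    then obtain a where "a \<in> F" by (auto simp: lattice_filter_def)
    then show "G \<subseteq> {c. \<exists>a\<in>F. \<exists>b\<in>G. a \<sqinter> b \<le> c}" using inf_le2 by blast
  qed
  show "F \<le> G \<sqinter> H" if "F \<le> G" "F \<le> H"
    using that by transfer (unfold lattice_filter_def, blast)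
  show "F \<le> F \<squnion> G" by transfer auto
  show "G \<le> F \<squnion> G" by transfer auto
  show "G \<squnion> H \<le> F" if "G \<le> F" "H \<le> F" using that by transfer auto
qed

end

instance fil :: (modular_lattice) modular_lattice
proof
  fix F G H :: "'a fil"
  assume "F \<le> H"
  then show "F \<squnion> (G \<sqinter> H) = (F \<squnion> G) \<sqinter> H"
  proof (rule_tac order_antisym)
    show "F \<squnion> (G \<sqinter> H) \<le> (F \<squnion> G) \<sqinter> H" if "F \<le> H"
      using that by (simp add: le_infI1 le_infI2)
    show "(F \<squnion> G) \<sqinter> H \<le> F \<squnion> (G \<sqinter> H)" if "F \<le> H"
      using that
    proof (transfer, clarsimp)
      fix F G H :: "'a set" and t b c
      assume fil: "lattice_filter F" "lattice_filter G" "lattice_filter H"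
        and "H \<subseteq> F" "t \<in> F" "b \<in> G" "c \<in> H" "b \<sqinter> c \<le> t"
      have "t \<sqinter> c \<in> F"
        using fil(1) \<open>H \<subseteq> F\<close> \<open>t \<in> F\<close> \<open>c \<in> H\<close> by (auto simp: lattice_filter_def)
      then have "(t \<sqinter> c) \<squnion> b \<in> F \<inter> G"
        using fil \<open>b \<in> G\<close> unfolding lattice_filter_def by (meson IntI sup_ge1 sup_ge2)
      moreover have "((t \<sqinter> c) \<squnion> b) \<sqinter> c \<le> t"
        using modular[of "t \<sqinter> c" c b] \<open>b \<sqinter> c \<le> t\<close> by (metis inf_le1 inf_le2 le_sup_iff)
      ultimately show "\<exists>a\<in>F \<inter> G. \<exists>b\<in>H. a \<sqinter> b \<le> t" using \<open>c \<in> H\<close> by blast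
    qed
  qed
qed

instantiation fil :: (complete_lattice) complete_lattice
begin

lift_definition bot_fil :: "'a fil" is UNIV
  by (simp add: lattice_filter_def)

lift_definition top_fil :: "'a fil" is "{\<top>}"
  by (auto simp: lattice_filter_def top_le)

lift_definition Sup_fil :: "'a fil set \<Rightarrow> 'a fil" is "\<lambda>\<F>. \<Inter>\<F>"
proof -
  fix \<F> :: "'a set set"
  assume fil: "\<And>F. F \<in> \<F> \<Longrightarrow> lattice_filter F"
  then have "\<top> \<in> F" if "F \<in> \<F>" for F
    using that unfolding lattice_filter_def by (metis all_not_in_conv top_greatest)
  then have "\<Inter>\<F> \<noteq> {}" by blast
  then show "lattice_filter (\<Inter>\<F>)"
    using fil by (simp add: lattice_filter_def) blast
qed

definition Inf_fil :: "'a fil set \<Rightarrow> 'a fil" where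
  "Inf_fil \<F> = \<Squnion>{G. \<forall>F\<in>\<F>. G \<le> F}"

instance
proof
  fix F G :: "'a fil" and \<F> :: "'a fil set"
  have upper: "F \<le> \<Squnion>\<F>" if "F \<in> \<F>" for F and \<F> :: "'a fil set"
    using that by transfer auto
  have least: "\<Squnion>\<F> \<le> G" if "\<And>F. F \<in> \<F> \<Longrightarrow> F \<le> G" for G and \<F> :: "'a fil set"
    using that by transfer auto
  show "F \<le> \<Squnion>\<F>" if "F \<in> \<F>" using that by (rule upper)
  show "\<Squnion>\<F> \<le> G" if "\<And>F. F \<in> \<F> \<Longrightarrow> F \<le> G" using that by (rule least)
  show "\<Sqinter>\<F> \<le> F" if "F \<in> \<F>" using that by (auto simp: Inf_fil_def intro: least)
  show "G \<le> \<Sqinter>\<F>" if "\<And>F. F \<in> \<F> \<Longrightarrow> G \<le> F" using that by (auto simp: Inf_fil_def intro: upper)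
  show "\<Squnion>{} = (\<bottom> :: 'a fil)" by transfer auto
  show "\<Sqinter>{} = (\<top> :: 'a fil)"
  proof (rule order_antisym)
    show "\<Sqinter>{} \<le> (\<top> :: 'a fil)"
    proof -
      have "F \<le> \<top>" for F :: "'a fil"
        by transfer (unfold lattice_filter_def, metis all_not_in_conv empty_subsetI insert_subset top_greatest)
      then show ?thesis .
    qed
    show "(\<top> :: 'a fil) \<le> \<Sqinter>{}" by (auto simp: Inf_fil_def intro: upper)
  qed
qed

end

instance fil :: (complete_modular_lattice) complete_modular_lattice ..

end

theory Submission
  imports Defs
begin

text \<open>
  Infima of chains of filters are unions, so every covering of filters is lower regular. For upper
  regularity, every covering \<open>F \<prec> G\<close> of filters that is projective to \<open>Fg x \<prec> Fg y\<close> satisfies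
  \<open>(F, G) \<nearrow> (Fg a, Fg b)\<close> for a covering \<open>a \<prec> b\<close> projective to \<open>x \<prec> y\<close>. Lower regularity in the
  lattice extends from chains to filters, so \<open>q = \<Sqinter>G\<close> is not below \<open>a\<close> and \<open>p = q \<sqinter> a\<close> is covered by
  \<open>q\<close>. For a chain of filters \<open>F'\<close> above \<open>F\<close> with \<open>G \<sqinter> F' = F\<close>, meet-continuity gives an element
  \<open>h\<close> above all the \<open>\<Sqinter>F'\<close> that is maximal with \<open>q \<sqinter> h \<le> p\<close>. If \<open>h\<close> were not in \<open>F'\<close>, lower
  regularity for \<open>h \<prec> h \<squnion> q\<close> along \<open>F'\<close> would contradict \<open>\<Sqinter>F' \<le> h\<close>. Hence \<open>h\<close> is in all the
  \<open>F'\<close>, but not in \<open>G\<close>, and the join of the \<open>F'\<close> is not above \<open>G\<close>.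
\<close>

section \<open>Coverings in modular lattices\<close>

lemma transposes_up_iff:
  "(x, y) \<nearrow> (z, w) \<longleftrightarrow> x \<le> y \<and> z \<le> w \<and> y \<sqinter> z = x \<and> y \<squnion> z = w"
  by (simp add: transposes_up_def)

lemma transposes_up_trans:
  assumes "(x, y) \<nearrow> (z, w)" "(z, w) \<nearrow> (s, t)"
  shows "(x, y) \<nearrow> (s, t)"
proof -
  have 1: "x \<le> y" "z \<le> w" "s \<le> t" "y \<sqinter> z = x" "y \<squnion> z = w" "w \<sqinter> s = z" "w \<squnion> s = t"
    using assms by (auto simp: transposes_up_iff)
  have "y \<sqinter> s = (y \<sqinter> w) \<sqinter> s" using 1 by (metis inf.absorb1 sup.cobounded1)
  also have "\<dots> = x" using 1 by (simp add: inf_assoc)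
  finally have "y \<sqinter> s = x" .
  have "y \<squnion> s = y \<squnion> (z \<squnion> s)" using 1 by (metis inf.cobounded2 sup.absorb2)
  also have "\<dots> = t" using 1 by (simp add: sup_assoc[symmetric])
  finally show ?thesis using 1 \<open>y \<sqinter> s = x\<close> by (simp add: transposes_up_iff)
qed

lemma proj_equiv_step:
  assumes "p \<nearrow> q \<or> q \<nearrow> p" "proj_equiv q s"
  shows "proj_equiv p s"
  using assms unfolding proj_equiv_def by (metis symclp_def tranclp_into_tranclp2)

lemma covering_less: "x \<prec> y \<Longrightarrow> x < y"
  by (simp add: covering_def)

lemma coveringD: "x \<prec> y \<Longrightarrow> x \<le> z \<Longrightarrow> z \<le> y \<Longrightarrow> z = x \<or> z = y"
  unfolding covering_def by (metis order.not_eq_order_implies_strict)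

text \<open>In a modular lattice the intervals of a transposed pair are isomorphic via
  \<open>\<lambda>s. z \<squnion> s\<close> and \<open>\<lambda>s. y \<sqinter> s\<close>. An
  element strictly inside one interval is carried to the other, and the modular law recovers it from
  its image.\<close>

lemma covering_transposes_up:
  fixes x y z w :: "'a::modular_lattice"
  assumes "(x, y) \<nearrow> (z, w)"
  shows "x \<prec> y \<longleftrightarrow> z \<prec> w"
proof
  have 1: "x \<le> y" "z \<le> w" "y \<sqinter> z = x" "y \<squnion> z = w"
    using assms by (auto simp: transposes_up_iff)
  show "z \<prec> w" if cov: "x \<prec> y"
    unfolding covering_def
  proof (intro conjI notI)
    show "z < w" using 1 covering_less[OF cov]
      by (metis inf.absorb1 order.not_eq_order_implies_strict order.strict_iff_not sup.cobounded1)
    assume "\<exists>s. z < s \<and> s < w"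
    then obtain s where s: "z < s" "s < w" by blast
    have "z \<squnion> (y \<sqinter> s) = s" using modular[of z s y] s 1 by (simp add: sup_commute inf.absorb2)
    moreover have "y \<sqinter> s = x \<or> y \<sqinter> s = y"
      by (rule coveringD[OF cov]) (use 1 s in \<open>auto intro: le_infI2 less_imp_le\<close>)
    ultimately show False using 1 s
      by (metis inf.cobounded2 order.strict_iff_not sup.absorb1 sup_commute)
  qed
  show "x \<prec> y" if cov: "z \<prec> w"
    unfolding covering_def
  proof (intro conjI notI)
    show "x < y" using 1 covering_less[OF cov]
      by (metis inf.cobounded2 order.not_eq_order_implies_strict order.strict_iff_not sup.absorb2 order_refl)
    assume "\<exists>s. x < s \<and> s < y"
    then obtain s where s: "x < s" "s < y" by blast
    have "s \<squnion> (z \<sqinter> y) = (s \<squnion> z) \<sqinter> y" using modular[of s y z] s by simp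
    then have eq: "(s \<squnion> z) \<sqinter> y = s" using 1 s by (simp add: inf_commute sup.absorb1)
    have "s \<squnion> z = z \<or> s \<squnion> z = w"
      by (rule coveringD[OF cov]) (use 1 s in \<open>auto intro: le_supI1 less_imp_le sup_mono\<close>)
    then show False using 1 s eq
      by (metis inf.absorb2 inf_commute order.strict_iff_not sup.cobounded1)
  qed
qed

text \<open>The join \<open>s \<squnion> a\<close> lies in the interval from \<open>a\<close> to
  \<open>b\<close> and differs from \<open>a\<close>, so it is \<open>b\<close>. This is the main
  source of new coverings projective to a given one.\<close>

lemma transposes_up_to_covering:
  assumes "a \<prec> b" "s \<le> b" "\<not> s \<le> a"
  shows "(s \<sqinter> a, s) \<nearrow> (a, b)"
proof -
  have "s \<squnion> a = b"
    using coveringD[OF assms(1), of "s \<squnion> a"] assms covering_less[OF assms(1)]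
    by (metis le_supI order.strict_implies_order sup.cobounded1 sup.cobounded2)
  then show ?thesis using covering_less[OF assms(1)]
    by (simp add: transposes_up_iff less_imp_le)
qed

text \<open>The covering at \<open>i0\<close> transposes up to the pair of joins: if
  \<open>G i0\<close> is not below the join of the \<open>F i\<close>, its meet with that join can
  only be \<open>F i0\<close>. Regularity is thereby reduced to refuting a single
  inequality.\<close>

lemma Sup_chain_covering:
  fixes F G :: "'i \<Rightarrow> 'a::complete_modular_lattice"
  assumes r: "linear_order_on I r" and i0: "i0 \<in> I" and cov: "F i0 \<prec> G i0"
    and tr: "\<And>i j. i \<in> I \<Longrightarrow> j \<in> I \<Longrightarrow> (i, j) \<in> r \<Longrightarrow> i \<noteq> j \<Longrightarrow> (F i, G i) \<nearrow> (F j, G j)"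
    and not_le: "\<not> G i0 \<le> (\<Squnion>i\<in>I. F i)"
  shows "(\<Squnion>i\<in>I. F i) \<prec> (\<Squnion>i\<in>I. G i)"
proof -
  have le: "F i0 \<le> (\<Squnion>i\<in>I. F i)" "G i0 \<le> (\<Squnion>i\<in>I. G i)" using i0 by (auto intro: SUP_upper)
  have G_le: "G j \<le> G i0 \<squnion> (\<Squnion>i\<in>I. F i)" if j: "j \<in> I" for j
  proof -
    have Fj: "F j \<le> (\<Squnion>i\<in>I. F i)" using j by (auto intro: SUP_upper)
    have "j = i0 \<or> (F i0, G i0) \<nearrow> (F j, G j) \<or> (F j, G j) \<nearrow> (F i0, G i0)"
      using r i0 j tr unfolding linear_order_on_def total_on_def by metis
    then show ?thesis
    proof (elim disjE)
      assume "(F i0, G i0) \<nearrow> (F j, G j)"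
      then have "G j = G i0 \<squnion> F j" by (simp add: transposes_up_iff)
      then show ?thesis using Fj by (simp add: le_supI2)
    next
      assume "(F j, G j) \<nearrow> (F i0, G i0)"
      then have "G j \<le> G i0" using transposes_up_mono by blast
      then show ?thesis by (rule le_supI1)
    qed simp
  qed
  have F_le_G: "F j \<le> (\<Squnion>i\<in>I. G i)" if j: "j \<in> I" for j
  proof -
    have "j = i0 \<or> (F i0, G i0) \<nearrow> (F j, G j) \<or> (F j, G j) \<nearrow> (F i0, G i0)"
      using r i0 j tr unfolding linear_order_on_def total_on_def by metis
    then have "F j \<le> G j"
      using covering_less[OF cov] by (auto simp: transposes_up_iff)
    then show ?thesis using j by (auto intro: SUP_upper2)
  qed
  have 1: "G i0 \<squnion> (\<Squnion>i\<in>I. F i) = (\<Squnion>i\<in>I. G i)"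
    by (intro order_antisym le_supI SUP_least G_le F_le_G le)
  have "G i0 \<sqinter> (\<Squnion>i\<in>I. F i) = F i0"
    using coveringD[OF cov, of "G i0 \<sqinter> (\<Squnion>i\<in>I. F i)"] le not_le covering_less[OF cov]
    by (metis inf.cobounded1 inf.orderI le_inf_iff less_imp_le)
  then have "(F i0, G i0) \<nearrow> (\<Squnion>i\<in>I. F i, \<Squnion>i\<in>I. G i)"
    using 1 covering_less[OF cov]
    by (auto simp: transposes_up_iff less_imp_le intro: SUP_least F_le_G)
  then show ?thesis using cov covering_transposes_up by blast
qed

text \<open>This is the preceding criterion in the dual lattice, where \<open>F\<close> and
  \<open>G\<close> exchange their roles.\<close>

lemma Inf_chain_covering:
  fixes F G :: "'i \<Rightarrow> 'a::complete_modular_lattice"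
  assumes r: "linear_order_on I r" and i0: "i0 \<in> I" and cov: "F i0 \<prec> G i0"
    and tr: "\<And>i j. i \<in> I \<Longrightarrow> j \<in> I \<Longrightarrow> (i, j) \<in> r \<Longrightarrow> i \<noteq> j \<Longrightarrow> (F j, G j) \<nearrow> (F i, G i)"
    and not_le: "\<not> (\<Sqinter>i\<in>I. G i) \<le> F i0"
  shows "(\<Sqinter>i\<in>I. F i) \<prec> (\<Sqinter>i\<in>I. G i)"
proof -
  have "(\<Squnion>i\<in>I. dual (G i)) \<prec> (\<Squnion>i\<in>I. dual (F i))"
  proof (rule Sup_chain_covering[OF r i0])
    show "\<not> dual (F i0) \<le> (\<Squnion>i\<in>I. dual (G i))"
    proof
      assume "dual (F i0) \<le> (\<Squnion>i\<in>I. dual (G i))"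
      then have "dual (F i0) \<le> dual (\<Sqinter>i\<in>I. G i)" by (simp add: image_image)
      then show False using not_le by (simp only: dual_less_eq_iff undual_dual)
    qed
  qed (use cov tr in \<open>auto simp: covering_dual transposes_up_dual\<close>)
  then have "dual (\<Sqinter>i\<in>I. G i) \<prec> dual (\<Sqinter>i\<in>I. F i)"
    by (simp add: image_image)
  then show ?thesis by (simp only: covering_dual)
qed


section \<open>Lower regularity and filters\<close>

text \<open>Zorn's lemma for a predicate, to be used with inclusion of filters, with the lattice
  order and with its reverse. The empty chain is covered by \<open>A \<noteq> {}\<close>, so only
  nonempty chains need a bound.\<close>

lemma Zorn_relation:
  assumes refl: "\<And>a. P a a" and antisym: "\<And>a b. P a b \<Longrightarrow> P b a \<Longrightarrow> a = b"
    and trans: "\<And>a b c. P a b \<Longrightarrow> P b c \<Longrightarrow> P a c"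
    and ne: "A \<noteq> {}"
    and chain: "\<And>C. C \<noteq> {} \<Longrightarrow> C \<subseteq> A \<Longrightarrow> (\<And>c d. c \<in> C \<Longrightarrow> d \<in> C \<Longrightarrow> P c d \<or> P d c) \<Longrightarrow>
      \<exists>u\<in>A. \<forall>c\<in>C. P c u"
  obtains m where "m \<in> A" "\<And>a. a \<in> A \<Longrightarrow> P m a \<Longrightarrow> a = m"
proof -
  have "\<exists>m\<in>A. \<forall>a\<in>A. P m a \<longrightarrow> a = m"
  proof (rule predicate_Zorn)
    show "partial_order_on A (relation_of P A)"
      by (rule partial_order_on_relation_ofI) (use assms in blast)+
    fix C assume C: "C \<in> Chains (relation_of P A)"
    show "\<exists>u\<in>A. \<forall>a\<in>C. P a u"
    proof (cases "C = {}")
      case True then show ?thesis using ne by blast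
    next
      case False
      show ?thesis
        by (rule chain[OF False]) (use C in \<open>auto simp: Chains_def relation_of_def\<close>)
    qed
  qed
  then show ?thesis using that by blast
qed

text \<open>Each \<open>c\<close> in \<open>C\<close> gives a covering
  \<open>c \<sqinter> a \<prec> c\<close> that transposes up to \<open>a \<prec> b\<close>. Lower
  regularity makes the infima of both ends a covering, whereas \<open>\<Sqinter>C \<le> a\<close>
  would make them equal.\<close>

lemma lower_regular_chain:
  fixes a b :: "'a::complete_modular_lattice"
  assumes reg: "lower_regular x y" and cov: "a \<prec> b" and proj: "proj_equiv (a, b) (x, y)"
    and ne: "C \<noteq> {}" and chain: "\<And>c d. c \<in> C \<Longrightarrow> d \<in> C \<Longrightarrow> c \<le> d \<or> d \<le> c"
    and le: "\<And>c. c \<in> C \<Longrightarrow> c \<le> b" and not_le: "\<And>c. c \<in> C \<Longrightarrow> \<not> c \<le> a"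
  shows "\<not> \<Sqinter>C \<le> a"
proof
  \<comment> \<open>The order is reversed because lower regularity speaks of families that descend
    as the index grows.\<close>
  let ?r = "{(c, d) \<in> C \<times> C. d \<le> c}"
  have tr: "(c \<sqinter> a, c) \<nearrow> (a, b)" if "c \<in> C" for c
    using that transposes_up_to_covering[OF cov] le not_le by blast
  have lin: "linear_order_on C ?r"
    unfolding order_on_defs refl_on_def total_on_def
    using chain by (auto intro!: transI antisymI)
  have "(\<Sqinter>c\<in>C. c \<sqinter> a) \<prec> (\<Sqinter>c\<in>C. c)"
  proof (rule lower_regularD[OF reg ne lin])
    fix c assume c: "c \<in> C"
    show "c \<sqinter> a \<prec> c" using covering_transposes_up[OF tr[OF c]] cov by simp
    show "proj_equiv (c \<sqinter> a, c) (x, y)" using proj_equiv_step tr[OF c] proj by blast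
    fix d assume d: "d \<in> C" "(c, d) \<in> ?r" "c \<noteq> d"
    then have "d \<sqinter> (c \<sqinter> a) = d \<sqinter> a" by (simp add: inf.absorb1 flip: inf_assoc)
    moreover have "(d \<sqinter> (c \<sqinter> a), d) \<nearrow> (c \<sqinter> a, c)"
      by (rule transposes_up_to_covering[OF \<open>c \<sqinter> a \<prec> c\<close>]) (use d not_le in auto)
    ultimately show "(d \<sqinter> a, d) \<nearrow> (c \<sqinter> a, c)" by simp
  qed
  moreover assume "\<Sqinter>C \<le> a"
  then have "\<Sqinter>C \<le> (\<Sqinter>c\<in>C. c \<sqinter> a)" by (auto intro!: INF_greatest intro: Inf_lower)
  ultimately show False using covering_less by fastforce
qed

text \<open>
  The passage from chains to filters: a filter that is maximal with the hypothesis below is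
  closed under infima of chains, hence principal.
\<close>
lemma lower_regular_filter:
  fixes a b :: "'a::complete_modular_lattice"
  assumes reg: "lower_regular x y" and cov: "a \<prec> b" and proj: "proj_equiv (a, b) (x, y)"
    and F: "lattice_filter F" and not_le: "\<And>v. v \<in> F \<Longrightarrow> \<not> v \<sqinter> b \<le> a"
  shows "\<not> \<Sqinter>F \<sqinter> b \<le> a"
proof -
  \<comment> \<open>Zorn's lemma applies because the union of a nonempty chain of such filters is
    again one.\<close>
  let ?A = "{E. lattice_filter E \<and> F \<subseteq> E \<and> (\<forall>v\<in>E. \<not> v \<sqinter> b \<le> a)}"
  obtain E where E: "E \<in> ?A" and maxE: "\<And>E'. E' \<in> ?A \<Longrightarrow> E \<subseteq> E' \<Longrightarrow> E' = E"
  proof (rule Zorn_relation[of "(\<subseteq>)" ?A])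
    show "?A \<noteq> {}" using F not_le by blast
    fix \<C> assume ne: "\<C> \<noteq> {}" and sub: "\<C> \<subseteq> ?A"
      and chain: "\<And>c d. c \<in> \<C> \<Longrightarrow> d \<in> \<C> \<Longrightarrow> c \<subseteq> d \<or> d \<subseteq> c"
    have fil: "lattice_filter E" if "E \<in> \<C>" for E using that sub by blast
    have "u \<sqinter> v \<in> \<Union>\<C>" if uv: "u \<in> \<Union>\<C>" "v \<in> \<Union>\<C>" for u v
    proof -
      obtain E where "E \<in> \<C>" "u \<in> E" "v \<in> E" using uv chain by blast
      then show ?thesis using fil unfolding lattice_filter_def by blast
    qed
    moreover have "v \<in> \<Union>\<C>" if "u \<in> \<Union>\<C>" "u \<le> v" for u v
      using that fil unfolding lattice_filter_def by blast
    moreover have "\<Union>\<C> \<noteq> {}"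
    proof -
      obtain E where "E \<in> \<C>" using ne by blast
      moreover from this obtain v where "v \<in> E" using fil unfolding lattice_filter_def by blast
      ultimately have "v \<in> \<Union>\<C>" by (rule UnionI)
      then show ?thesis by (metis empty_iff)
    qed
    ultimately have "lattice_filter (\<Union>\<C>)" unfolding lattice_filter_def by blast
    then have "\<Union>\<C> \<in> ?A" using ne sub by blast
    then show "\<exists>U\<in>?A. \<forall>E\<in>\<C>. E \<subseteq> U" by blast
  qed auto
  have meet: "u \<sqinter> v \<in> E" if "u \<in> E" "v \<in> E" for u v
    using that E unfolding lattice_filter_def by blast
  \<comment> \<open>By maximality, the filter generated by \<open>E\<close> and \<open>c\<close>
    must contain some \<open>v\<close> with \<open>v \<sqinter> b \<le> a\<close>.\<close>
  have ext: "\<exists>e\<in>E. (e \<sqinter> c) \<sqinter> b \<le> a" if c: "c \<notin> E" for c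
  proof (rule ccontr)
    assume *: "\<not> ?thesis"
    let ?E = "{v. \<exists>e\<in>E. e \<sqinter> c \<le> v}"
    have "E \<noteq> {}" using E unfolding lattice_filter_def by blast
    have "lattice_filter ?E"
      unfolding lattice_filter_def
    proof (intro conjI ballI allI impI)
      show "?E \<noteq> {}" using \<open>E \<noteq> {}\<close> by blast
      show "v \<in> ?E" if "u \<in> ?E" "u \<le> v" for u v using that order_trans by blast
      show "u \<sqinter> v \<in> ?E" if uv: "u \<in> ?E" "v \<in> ?E" for u v
      proof -
        obtain e e' where e: "e \<in> E" "e' \<in> E" "e \<sqinter> c \<le> u" "e' \<sqinter> c \<le> v" using uv by blast
        then have "(e \<sqinter> e') \<sqinter> c \<le> u \<sqinter> v"
          by (meson inf.cobounded1 inf.cobounded2 inf_greatest inf_mono order_refl order_trans)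
        then show ?thesis using meet e by blast
      qed
    qed
    moreover have "E \<subseteq> ?E" using inf_le1 by blast
    moreover have "\<not> v \<sqinter> b \<le> a" if v: "v \<in> ?E" for v
    proof
      assume le: "v \<sqinter> b \<le> a"
      obtain e where e: "e \<in> E" "e \<sqinter> c \<le> v" using v by blast
      then have "(e \<sqinter> c) \<sqinter> b \<le> v \<sqinter> b" by (intro inf_mono order_refl)
      then show False using * e le order_trans by blast
    qed
    ultimately have "?E = E" using E by (intro maxE) auto
    moreover have "c \<in> ?E" using \<open>E \<noteq> {}\<close> inf_le2 by blast
    ultimately show False using c by blast
  qed
  obtain m where m: "m \<in> E" and min: "\<And>e. e \<in> E \<Longrightarrow> e \<le> m \<Longrightarrow> e = m"
  proof (rule Zorn_relation[of "(\<ge>)" E])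
    show "E \<noteq> {}" using E unfolding lattice_filter_def by blast
    fix C assume ne: "C \<noteq> {}" and sub: "C \<subseteq> E"
      and chain: "\<And>c d. c \<in> C \<Longrightarrow> d \<in> C \<Longrightarrow> d \<le> c \<or> c \<le> d"
    have "\<Sqinter>C \<in> E"
    \<comment> \<open>The elements \<open>(e \<sqinter> c) \<sqinter> b\<close> form a chain, and
      none is below \<open>a\<close> because \<open>e \<sqinter> c\<close> is in \<open>E\<close>.
      By the chain version their infimum is not below \<open>a\<close> either, against the choice of
      \<open>e\<close>.\<close>
    proof (rule ccontr)
      assume "\<Sqinter>C \<notin> E"
      then obtain e where e: "e \<in> E" "(e \<sqinter> \<Sqinter>C) \<sqinter> b \<le> a" using ext by blast
      let ?C = "(\<lambda>c. (e \<sqinter> c) \<sqinter> b) ` C"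
      have "\<not> \<Sqinter>?C \<le> a"
      proof (rule lower_regular_chain[OF reg cov proj])
        show "?C \<noteq> {}" using ne by simp
        show "c \<le> d \<or> d \<le> c" if cd: "c \<in> ?C" "d \<in> ?C" for c d
        proof -
          obtain c' d' where "c' \<in> C" "d' \<in> C" and [simp]: "c = (e \<sqinter> c') \<sqinter> b" "d = (e \<sqinter> d') \<sqinter> b"
            using cd by blast
          then have "c' \<le> d' \<or> d' \<le> c'" using chain by blast
          then show ?thesis by (auto intro: le_infI1 le_infI2)
        qed
        show "\<not> c \<le> a" if c: "c \<in> ?C" for c
        proof -
          obtain c' where "c' \<in> C" and [simp]: "c = (e \<sqinter> c') \<sqinter> b" using c by blast
          then have "e \<sqinter> c' \<in> E" using sub e meet by blast
          then show ?thesis using E by simp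
        qed
      qed auto
      moreover have "\<Sqinter>?C \<le> (e \<sqinter> \<Sqinter>C) \<sqinter> b"
      proof -
        have 1: "\<Sqinter>?C \<le> (e \<sqinter> c) \<sqinter> b" if "c \<in> C" for c using that by (rule INF_lower)
        then have "\<Sqinter>?C \<le> \<Sqinter>C" by (meson Inf_greatest le_inf_iff)
        with 1 ne show ?thesis by (metis all_not_in_conv le_inf_iff)
      qed
      ultimately show False using e by (meson order_trans)
    qed
    then show "\<exists>u\<in>E. \<forall>c\<in>C. c \<ge> u" by (auto intro: Inf_lower)
  qed auto
  \<comment> \<open>Closure under meets turns the minimal element \<open>m\<close> of
    \<open>E\<close> into its least element, and \<open>F\<close> is contained in
    \<open>E\<close>.\<close>
  have "m \<le> \<Sqinter>F"
  proof (rule Inf_greatest)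
    fix v assume "v \<in> F"
    then have "m \<sqinter> v = m" using E m meet by (intro min) auto
    then show "m \<le> v" by (metis inf.cobounded2)
  qed
  then have "m \<sqinter> b \<le> \<Sqinter>F \<sqinter> b" by (rule inf_mono) simp
  moreover have "\<not> m \<sqinter> b \<le> a" using E m by blast
  ultimately show ?thesis by (meson order_trans)
qed


section \<open>Coverings in the lattice of filters\<close>

lemma lattice_filter_elems: "lattice_filter (elems F)"
  using elems by blast

lemma elems_upD: "a \<in> elems F \<Longrightarrow> a \<le> b \<Longrightarrow> b \<in> elems F"
  using lattice_filter_elems unfolding lattice_filter_def by blast

lemma elems_infI: "a \<in> elems F \<Longrightarrow> b \<in> elems F \<Longrightarrow> a \<sqinter> b \<in> elems F"
  using lattice_filter_elems unfolding lattice_filter_def by blast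

lemma elems_nonempty: "elems F \<noteq> {}"
  using lattice_filter_elems unfolding lattice_filter_def by blast

lemma le_Fg_iff: "F \<le> Fg a \<longleftrightarrow> a \<in> elems F"
proof
  show "a \<in> elems F" if "F \<le> Fg a" using that by transfer auto
  show "F \<le> Fg a" if "a \<in> elems F" using that by (auto simp: less_eq_fil.rep_eq Fg.rep_eq intro: elems_upD)
qed

lemma mem_elems_Fg: "b \<in> elems (Fg a) \<longleftrightarrow> a \<le> b"
  by transfer simp

lemma Fg_le_Fg_iff: "Fg a \<le> Fg b \<longleftrightarrow> a \<le> b"
  by (simp add: le_Fg_iff mem_elems_Fg)

lemma Fg_sup: "Fg a \<squnion> Fg b = Fg (a \<squnion> b)"
  by transfer auto

text \<open>A filter strictly between would contain \<open>y\<close> but not \<open>x\<close>. Its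
  elements met with \<open>y\<close> stay between \<open>x\<close> and \<open>y\<close> and are not
  \<open>x\<close>, so all of them are above \<open>y\<close>.\<close>

lemma Fg_covering:
  assumes "x \<prec> y" shows "Fg x \<prec> Fg y"
  unfolding covering_def
proof (intro conjI notI)
  show "Fg x < Fg y" using covering_less[OF assms] by (simp add: less_le_not_le Fg_le_Fg_iff)
  assume "\<exists>F. Fg x < F \<and> F < Fg y"
  then obtain F where F: "Fg x < F" "F < Fg y" by blast
  then have y: "y \<in> elems F" and x: "x \<notin> elems F"
    by (auto simp: less_le_not_le le_Fg_iff)
  have x_le: "x \<le> f" if "f \<in> elems F" for f
    using that F by (metis Fg_le_Fg_iff le_Fg_iff less_imp_le order_trans)
  have "Fg y \<le> F"
    unfolding less_eq_fil.rep_eq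
  proof
    fix f assume f: "f \<in> elems F"
    then have *: "f \<sqinter> y \<in> elems F" using y by (rule elems_infI)
    then have "f \<sqinter> y = y"
      using coveringD[OF assms x_le[OF *]] x by auto
    then show "f \<in> elems (Fg y)" by (metis inf.cobounded1 mem_elems_Fg)
  qed
  then show False using F by simp
qed

lemma inf_filter_le_iff: "F \<sqinter> G \<le> Fg c \<longleftrightarrow> (\<exists>a\<in>elems F. \<exists>b\<in>elems G. a \<sqinter> b \<le> c)"
  by (simp add: le_Fg_iff inf_fil.rep_eq)

text \<open>This handles an upward step of a projectivity. The inequality
  \<open>G \<sqinter> F' \<le> Fg a\<close> is witnessed by one element of \<open>G\<close> and one
  of \<open>F'\<close>, which brings the step down to coverings of the lattice itself.\<close>

lemma covering_below_principal_lift: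
  fixes a b :: "'a::modular_lattice"
  assumes cov: "a \<prec> b" and up: "(F, G) \<nearrow> (Fg a, Fg b)" and tr: "(F, G) \<nearrow> (F', G')"
  obtains c d s where "(s, d) \<nearrow> (a, b)" "(s, d) \<nearrow> (c, c \<squnion> d)" "(F', G') \<nearrow> (Fg c, Fg (c \<squnion> d))"
proof -
  have FG: "F \<prec> G" using covering_transposes_up[OF up] Fg_covering[OF cov] by blast
  then have FG': "F' \<prec> G'" using covering_transposes_up[OF tr] by blast
  have up': "G \<sqinter> Fg a = F" "G \<squnion> Fg a = Fg b" and tr': "G \<sqinter> F' = F" "G \<squnion> F' = G'"
    using up tr by (auto simp: transposes_up_iff)
  have b: "b \<in> elems G" using up' by (metis le_Fg_iff sup.cobounded1)
  have a: "a \<notin> elems G" using up' covering_less[OF cov]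
    by (metis Fg_le_Fg_iff le_Fg_iff order.strict_iff_not sup.absorb2)
  have "F \<le> Fg a" using up' by (metis inf.cobounded2)
  then obtain g0 f where 0: "g0 \<in> elems G" "f \<in> elems F'" "g0 \<sqinter> f \<le> a"
    using tr' inf_filter_le_iff by metis
  \<comment> \<open>Cutting down to \<open>b\<close> puts \<open>g\<close> in the position where
    \<open>(g \<sqinter> a, g)\<close> transposes up to \<open>(a, b)\<close>.\<close>
  define g where "g = g0 \<sqinter> b"
  have g: "g \<in> elems G" "g \<le> b" using 0 b by (auto simp: g_def intro: elems_infI)
  have "g \<sqinter> f \<le> g0 \<sqinter> f" by (auto simp: g_def intro: le_infI1)
  then have gf: "g \<sqinter> f \<le> a" using 0 by (meson order_trans)
  have ga: "\<not> g \<le> a" using a g elems_upD by blast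
  have s: "(g \<sqinter> a, g) \<nearrow> (a, b)" by (rule transposes_up_to_covering[OF cov g(2) ga])
  then have covg: "g \<sqinter> a \<prec> g" using covering_transposes_up cov by blast
  \<comment> \<open>Enlarging \<open>f\<close> by \<open>g \<sqinter> a\<close> keeps it in
    \<open>F'\<close> and, by the modular law, makes its meet with \<open>g\<close> exactly
    \<open>g \<sqinter> a\<close>.\<close>
  define c where "c = f \<squnion> (g \<sqinter> a)"
  have c: "c \<in> elems F'" using 0 elems_upD c_def by (metis sup.cobounded1)
  have "g \<sqinter> c = g \<sqinter> a"
    using modular[of "g \<sqinter> a" g f] gf by (simp add: c_def sup_commute inf_commute sup.absorb1)
  then have st: "(g \<sqinter> a, g) \<nearrow> (c, c \<squnion> g)" by (simp add: transposes_up_iff sup_commute)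
  then have covc: "c \<prec> c \<squnion> g" using covering_transposes_up covg by blast
  have cG: "c \<notin> elems G"
    using a g elems_infI[of g G c] elems_upD \<open>g \<sqinter> c = g \<sqinter> a\<close> by (metis inf.cobounded2)
  have F'c: "F' \<le> Fg c" using c by (simp add: le_Fg_iff)
  have cG': "\<not> G' \<le> Fg c" using cG tr' by (metis le_Fg_iff le_sup_iff)
  \<comment> \<open>Since \<open>G'\<close> is not below \<open>Fg c\<close>, the covering
    \<open>F' \<prec> G'\<close> determines this meet, and the covering of \<open>Fg c\<close> by
    \<open>Fg (c \<squnion> g)\<close> determines the join below.\<close>
  have "Fg c \<sqinter> G' = F'"
    using coveringD[OF FG', of "Fg c \<sqinter> G'"] F'c cG' covering_less[OF FG']
    by (metis inf.cobounded1 inf.cobounded2 le_inf_iff less_imp_le)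
  moreover have "Fg c \<squnion> G' = Fg (c \<squnion> g)"
  proof -
    have "G \<le> Fg g" using g by (simp add: le_Fg_iff)
    then have "G' \<le> Fg (c \<squnion> g)" using tr' F'c
      by (metis Fg_sup le_supI1 le_supI2 sup.bounded_iff)
    then have "Fg c \<squnion> G' \<le> Fg (c \<squnion> g)" by (simp add: Fg_le_Fg_iff)
    then have "Fg c \<squnion> G' = Fg c \<or> ?thesis"
      by (intro coveringD[OF Fg_covering[OF covc]]) auto
    then show ?thesis using cG' by (metis sup.cobounded2)
  qed
  ultimately have "(F', G') \<nearrow> (Fg c, Fg (c \<squnion> g))"
    using FG' by (auto simp: transposes_up_iff inf_commute sup_commute covering_less less_imp_le Fg_le_Fg_iff)
  then show ?thesis using that s st by blast
qed

text \<open>Induction along the projectivity, starting from its end \<open>(Fg x, Fg y)\<close>: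
  downward steps compose by transitivity of transposition, and upward steps use the preceding
  lemma.\<close>

lemma projective_covering_below_principal:
  fixes x y :: "'a::modular_lattice"
  assumes cov: "x \<prec> y" and "proj_equiv (F, G) (Fg x, Fg y)"
  obtains a b where "a \<prec> b" "proj_equiv (a, b) (x, y)" "(F, G) \<nearrow> (Fg a, Fg b)"
proof -
  have "\<exists>a b. a \<prec> b \<and> proj_equiv (a, b) (x, y) \<and> p \<nearrow> (Fg a, Fg b)"
    if "(symclp (\<nearrow>))\<^sup>*\<^sup>* p (Fg x, Fg y)" for p :: "'a fil \<times> 'a fil"
    using that
  proof (induction rule: converse_rtranclp_induct)
    case base
    have "(x, y) \<nearrow> (x, y)" "(Fg x, Fg y) \<nearrow> (Fg x, Fg y)"
      using covering_less[OF cov] by (auto intro!: transposes_up_refl simp: Fg_le_Fg_iff)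
    then show ?case using cov unfolding proj_equiv_def by (blast intro: symclpI1)
  next
    case (step p q)
    obtain F G F' G' where pq: "p = (F', G')" "q = (F, G)" by fastforce
    obtain a b where ab: "a \<prec> b" "proj_equiv (a, b) (x, y)" "(F, G) \<nearrow> (Fg a, Fg b)"
      using step.IH pq by blast
    from step.hyps(1) consider "(F', G') \<nearrow> (F, G)" | "(F, G) \<nearrow> (F', G')"
      unfolding pq symclp_def by blast
    then show ?case
    proof cases
      case 1
      then show ?thesis using ab pq transposes_up_trans by blast
    next
      case 2
      obtain c d s where cd: "(s, d) \<nearrow> (a, b)" "(s, d) \<nearrow> (c, c \<squnion> d)"
        "(F', G') \<nearrow> (Fg c, Fg (c \<squnion> d))"
        using covering_below_principal_lift[OF ab(1,3) 2] by blast
      have "c \<prec> c \<squnion> d" using ab(1) cd covering_transposes_up by blast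
      moreover have "proj_equiv (c, c \<squnion> d) (x, y)"
        using cd ab(2) proj_equiv_step by blast
      ultimately show ?thesis using cd pq by blast
    qed
  qed
  then show ?thesis using assms(2) that unfolding proj_equiv_def by (meson tranclp_into_rtranclp)
qed


section \<open>Regularity in the lattice of filters\<close>

text \<open>This refutes the inequality required by \<open>Sup_chain_covering\<close>: an element
  \<open>h\<close> is found that lies in every member of \<open>\<F>\<close> but not in
  \<open>G\<close>.\<close>

lemma not_le_Sup_chain_filters:
  fixes a b :: "'a::{complete_modular_lattice, meet_continuous_lattice}"
  assumes reg: "lower_regular x y" and cov: "a \<prec> b" and proj: "proj_equiv (a, b) (x, y)"
    and up: "(F0, G) \<nearrow> (Fg a, Fg b)"
    and ne: "\<F> \<noteq> {}" and chain: "\<And>F F'. F \<in> \<F> \<Longrightarrow> F' \<in> \<F> \<Longrightarrow> F \<le> F' \<or> F' \<le> F"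
    and inf: "\<And>F. F \<in> \<F> \<Longrightarrow> G \<sqinter> F = F0"
  shows "\<not> G \<le> \<Squnion>\<F>"
proof -
  have up': "G \<sqinter> Fg a = F0" "G \<squnion> Fg a = Fg b" using up by (auto simp: transposes_up_iff)
  have b: "b \<in> elems G" using up' by (metis le_Fg_iff sup.cobounded1)
  have a: "a \<notin> elems G" using up' covering_less[OF cov]
    by (metis Fg_le_Fg_iff le_Fg_iff order.strict_iff_not sup.absorb2)
  \<comment> \<open>\<open>Fg q\<close> is the largest principal filter below
    \<open>G\<close>.\<close>
  define q where "q = \<Sqinter>(elems G)"
  define p where "p = q \<sqinter> a"
  have "\<not> q \<sqinter> b \<le> a"
    unfolding q_def
    by (rule lower_regular_filter[OF reg cov proj lattice_filter_elems])
       (use a b elems_infI elems_upD in blast)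
  moreover have "q \<le> b" using b by (simp add: q_def Inf_lower)
  ultimately have qa: "\<not> q \<le> a" by (simp add: inf.absorb1)
  have pq: "(p, q) \<nearrow> (a, b)"
    unfolding p_def by (rule transposes_up_to_covering[OF cov \<open>q \<le> b\<close> qa])
  then have covq: "p \<prec> q" using cov covering_transposes_up by blast
  have q_Inf: "q \<sqinter> \<Sqinter>(elems F) \<le> p" if F: "F \<in> \<F>" for F
  proof -
    have "G \<sqinter> F \<le> Fg a" using inf[OF F] up' by (metis inf.cobounded2)
    then obtain g f where gf: "g \<in> elems G" "f \<in> elems F" "g \<sqinter> f \<le> a"
      using inf_filter_le_iff by metis
    have "q \<sqinter> \<Sqinter>(elems F) \<le> g \<sqinter> f" unfolding q_def by (intro inf_mono Inf_lower gf)
    also have "g \<sqinter> f \<le> a" by (rule gf)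
    finally show ?thesis by (simp add: p_def)
  qed
  \<comment> \<open>These infima form a chain, as smaller filters in this order are larger sets.
    Meet-continuity extends the bound \<open>q_Inf\<close> to their join.\<close>
  define D where "D = (\<lambda>F. \<Sqinter>(elems F)) ` \<F>"
  have "up_directed D"
    unfolding up_directed_def
  proof (intro conjI ballI)
    show "D \<noteq> {}" using ne by (simp add: D_def)
    fix d e assume "d \<in> D" "e \<in> D"
    moreover from this have "d \<le> e \<or> e \<le> d"
      using chain unfolding D_def by (auto simp: less_eq_fil.rep_eq) (meson Inf_superset_mono)
    ultimately show "\<exists>f\<in>D. d \<le> f \<and> e \<le> f" by blast
  qed
  then have qD: "q \<sqinter> \<Squnion>D \<le> p"
    using q_Inf by (auto simp: meet_continuous D_def intro!: SUP_least)
  let ?A = "{h. \<Squnion>D \<le> h \<and> q \<sqinter> h \<le> p}"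
  obtain h where h: "\<Squnion>D \<le> h" "q \<sqinter> h \<le> p" and max: "\<And>h'. h' \<in> ?A \<Longrightarrow> h \<le> h' \<Longrightarrow> h' = h"
  proof (rule Zorn_relation[of "(\<le>)" ?A])
    show "?A \<noteq> {}" using qD by blast
    fix C assume C: "C \<noteq> {}" "C \<subseteq> ?A" "\<And>c d. c \<in> C \<Longrightarrow> d \<in> C \<Longrightarrow> c \<le> d \<or> d \<le> c"
    then have "up_directed C" unfolding up_directed_def by blast
    then have "q \<sqinter> \<Squnion>C = (\<Squnion>c\<in>C. q \<sqinter> c)" by (rule meet_continuous)
    also have "\<dots> \<le> p" using C by (auto intro!: SUP_least)
    finally have "q \<sqinter> \<Squnion>C \<le> p" .
    moreover have "\<Squnion>D \<le> \<Squnion>C" using C by (metis (no_types, lifting) CollectD Sup_upper2 all_not_in_conv subsetD)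
    ultimately show "\<exists>u\<in>?A. \<forall>c\<in>C. c \<le> u" by (auto intro: Sup_upper)
  qed auto
  \<comment> \<open>By the modular law, joining \<open>p\<close> to \<open>h\<close> keeps the meet
    with \<open>q\<close> within \<open>p\<close>; maximality then gives
    \<open>p \<le> h\<close>.\<close>
  have "p \<squnion> (h \<sqinter> q) = (p \<squnion> h) \<sqinter> q" using covering_less[OF covq] by (intro modular) simp
  then have "q \<sqinter> (h \<squnion> p) \<le> p" using h by (simp add: inf_commute sup_commute sup.absorb1)
  then have "h \<squnion> p = h" using h by (intro max) (auto intro: le_supI1)
  then have "p \<le> h" by (metis sup.cobounded2)
  then have qh: "q \<sqinter> h = p" using h covering_less[OF covq] by (auto intro!: order_antisym)
  then have tr: "(p, q) \<nearrow> (h, h \<squnion> q)"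
    using covering_less[OF covq] by (simp add: transposes_up_iff sup_commute less_imp_le)
  have covh: "h \<prec> h \<squnion> q" using tr covq covering_transposes_up by blast
  have projh: "proj_equiv (h, h \<squnion> q) (x, y)" using tr pq proj proj_equiv_step by blast
  have "h \<in> elems F" if F: "F \<in> \<F>" for F
  proof (rule ccontr)
    assume hF: "h \<notin> elems F"
    \<comment> \<open>If some \<open>v\<close> in \<open>F\<close> violated the hypothesis of the
      filter lemma, \<open>h \<squnion> v\<close> would still meet \<open>q\<close> within
      \<open>p\<close>. Maximality would give \<open>v \<le> h\<close>, hence \<open>h\<close> in
      \<open>F\<close>.\<close>
    have "\<not> \<Sqinter>(elems F) \<sqinter> (h \<squnion> q) \<le> h"
    proof (rule lower_regular_filter[OF reg covh projh lattice_filter_elems], rule notI)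
      fix v assume v: "v \<in> elems F" and le: "v \<sqinter> (h \<squnion> q) \<le> h"
      have "(h \<squnion> v) \<sqinter> (h \<squnion> q) = h"
        using modular[of h "h \<squnion> q" v] le by (simp add: sup.absorb1)
      then have "q \<sqinter> (h \<squnion> v) \<le> q \<sqinter> h"
        by (metis inf.bounded_iff inf.cobounded1 inf.cobounded2 inf_mono order_refl sup.cobounded2)
      then have "h \<squnion> v = h" using qh h by (intro max) (auto intro: le_supI1)
      then show False using v hF elems_upD by (metis sup.cobounded2)
    qed
    moreover have "\<Sqinter>(elems F) \<le> \<Squnion>D" using F by (auto simp: D_def intro: SUP_upper)
    ultimately show False using h by (meson inf.coboundedI1 order_trans)
  qed
  then have "\<Squnion>\<F> \<le> Fg h" by (intro Sup_least) (simp add: le_Fg_iff)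
  moreover have "h \<notin> elems G"
  proof
    assume "h \<in> elems G"
    then have "q \<le> h" by (simp add: q_def Inf_lower)
    then show False using qh covering_less[OF covq] by (simp add: inf.absorb1)
  qed
  ultimately show ?thesis by (metis le_Fg_iff order_trans)
qed

lemma upper_regular_Fg:
  fixes x y :: "'a::{complete_modular_lattice, meet_continuous_lattice}"
  assumes cov: "x \<prec> y" and reg: "lower_regular x y"
  shows "upper_regular (Fg x) (Fg y)"
  unfolding upper_regular_def
proof (intro allI impI, elim conjE)
  fix I :: "('a fil \<times> 'a fil) set" and r F G
  assume ne: "I \<noteq> {}" and r: "linear_order_on I r"
    and FG: "\<forall>i\<in>I. F i \<prec> G i \<and> proj_equiv (F i, G i) (Fg x, Fg y)"
    and tr: "\<forall>i\<in>I. \<forall>j\<in>I. (i, j) \<in> r \<and> i \<noteq> j \<longrightarrow> (F i, G i) \<nearrow> (F j, G j)"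
  have tr': "i = j \<or> (F i, G i) \<nearrow> (F j, G j) \<or> (F j, G j) \<nearrow> (F i, G i)"
    if "i \<in> I" "j \<in> I" for i j
    using r tr that unfolding linear_order_on_def total_on_def by metis
  obtain i0 where i0: "i0 \<in> I" using ne by blast
  obtain a b where ab: "a \<prec> b" "proj_equiv (a, b) (x, y)" "(F i0, G i0) \<nearrow> (Fg a, Fg b)"
    using projective_covering_below_principal[OF cov] FG i0 by blast
  \<comment> \<open>Only coverings at or above the one at \<open>i0\<close> satisfy
    \<open>G i0 \<sqinter> F i = F i0\<close> directly. The others have
    \<open>F i \<le> F i0\<close> and do not change the join.\<close>
  let ?F = "F ` {i \<in> I. (F i0, G i0) \<nearrow> (F i, G i)}"
  have "F i0 \<prec> G i0" using FG i0 by blast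
  then have refl: "(F i0, G i0) \<nearrow> (F i0, G i0)"
    by (intro transposes_up_refl less_imp_le covering_less)
  have "\<not> G i0 \<le> \<Squnion>?F"
  proof (rule not_le_Sup_chain_filters[OF reg ab])
    show "?F \<noteq> {}" using refl i0 by blast
    show "G i0 \<sqinter> H = F i0" if "H \<in> ?F" for H using that by (auto simp: transposes_up_iff)
    show "H \<le> H' \<or> H' \<le> H" if "H \<in> ?F" "H' \<in> ?F" for H H'
      using that tr' transposes_up_mono by fastforce
  qed
  moreover have "(\<Squnion>i\<in>I. F i) \<le> \<Squnion>?F"
  proof (rule SUP_least)
    fix i assume i: "i \<in> I"
    show "F i \<le> \<Squnion>?F"
    proof (cases "(F i0, G i0) \<nearrow> (F i, G i)")
      case True then show ?thesis using i by (auto intro: SUP_upper)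
    next
      case False
      then have "F i \<le> F i0" using tr'[OF i i0] refl transposes_up_mono by blast
      also have "F i0 \<le> \<Squnion>?F" using i0 refl by (auto intro: SUP_upper)
      finally show ?thesis .
    qed
  qed
  ultimately have "\<not> G i0 \<le> (\<Squnion>i\<in>I. F i)" by (meson order_trans)
  then show "(\<Squnion>i\<in>I. F i) \<prec> (\<Squnion>i\<in>I. G i)"
    using Sup_chain_covering[OF r i0] FG tr i0 by blast
qed

text \<open>The union of a nonempty chain of filters is a filter, and under reverse inclusion it is
  a lower bound of the chain. Hence it is below the infimum, and so contains
  \<open>a\<close>.\<close>

lemma Inf_chain_filters_le_Fg:
  fixes \<G> :: "'a::complete_lattice fil set"
  assumes ne: "\<G> \<noteq> {}" and chain: "\<And>F G. F \<in> \<G> \<Longrightarrow> G \<in> \<G> \<Longrightarrow> F \<le> G \<or> G \<le> F"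
    and le: "\<Sqinter>\<G> \<le> Fg a"
  shows "\<exists>G\<in>\<G>. a \<in> elems G"
proof -
  define U where "U = \<Union>(elems ` \<G>)"
  have "u \<sqinter> v \<in> U" if uv: "u \<in> U" "v \<in> U" for u v
  proof -
    obtain F G where FG: "F \<in> \<G>" "u \<in> elems F" "G \<in> \<G>" "v \<in> elems G" using uv by (auto simp: U_def)
    then have "elems F \<subseteq> elems G \<or> elems G \<subseteq> elems F"
      using chain[of F G] by (auto simp: less_eq_fil.rep_eq)
    then have "u \<sqinter> v \<in> elems F \<or> u \<sqinter> v \<in> elems G"
      using FG elems_infI[of u _ v] by blast
    then show ?thesis using FG by (auto simp: U_def)
  qed
  moreover have "v \<in> U" if "u \<in> U" "u \<le> v" for u v
    using that elems_upD by (auto simp: U_def)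
  moreover have "U \<noteq> {}"
  proof -
    obtain G where G: "G \<in> \<G>" using ne by blast
    obtain v where "v \<in> elems G" using elems_nonempty[of G] by blast
    then show ?thesis using G by (auto simp: U_def)
  qed
  ultimately have "lattice_filter U" unfolding lattice_filter_def by blast
  then have elems_U: "elems (Abs_fil U) = U" by (simp add: Abs_fil_inverse)
  have "Abs_fil U \<le> \<Sqinter>\<G>"
  proof (rule Inf_greatest)
    fix F assume "F \<in> \<G>"
    then show "Abs_fil U \<le> F" unfolding less_eq_fil.rep_eq elems_U by (auto simp: U_def)
  qed
  then have "a \<in> U" using le elems_U by (metis le_Fg_iff order_trans)
  then show ?thesis by (auto simp: U_def)
qed

lemma lower_regular_fil:
  fixes A B :: "'a::complete_modular_lattice fil"
  shows "lower_regular A B"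
  unfolding lower_regular_def
proof (intro allI impI, elim conjE)
  fix I :: "('a fil \<times> 'a fil) set" and r F G
  assume ne: "I \<noteq> {}" and r: "linear_order_on I r"
    and FG: "\<forall>i\<in>I. F i \<prec> G i \<and> proj_equiv (F i, G i) (A, B)"
    and tr: "\<forall>i\<in>I. \<forall>j\<in>I. (i, j) \<in> r \<and> i \<noteq> j \<longrightarrow> (F j, G j) \<nearrow> (F i, G i)"
  have tr': "i = j \<or> (F i, G i) \<nearrow> (F j, G j) \<or> (F j, G j) \<nearrow> (F i, G i)"
    if "i \<in> I" "j \<in> I" for i j
    using r tr that unfolding linear_order_on_def total_on_def by metis
  obtain i0 where i0: "i0 \<in> I" using ne by blast
  then have "\<not> G i0 \<le> F i0" using FG by (auto simp: less_le_not_le dest!: covering_less)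
  then obtain a where a: "a \<in> elems (F i0)" "a \<notin> elems (G i0)"
    by (auto simp: less_eq_fil.rep_eq)
  \<comment> \<open>Joins of filters are intersections: if the covering at \<open>i\<close>
    transposes up to that at \<open>i0\<close>, then \<open>G i\<close> and \<open>F i0\<close>
    intersect in \<open>G i0\<close>. In the opposite case \<open>G i\<close> is a subset of
    \<open>G i0\<close>.\<close>
  have "a \<notin> elems (G i)" if i: "i \<in> I" for i
    using tr'[OF i i0]
  proof (elim disjE)
    assume "(F i, G i) \<nearrow> (F i0, G i0)"
    then have "elems (G i) \<inter> elems (F i0) = elems (G i0)"
      by (auto simp: transposes_up_iff simp flip: sup_fil.rep_eq)
    then show ?thesis using a by blast
  next
    assume "(F i0, G i0) \<nearrow> (F i, G i)"
    then have "G i0 \<le> G i" using transposes_up_mono by blast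
    then show ?thesis using a by (auto simp: less_eq_fil.rep_eq)
  qed (use a in simp)
  moreover have "\<exists>H\<in>G ` I. a \<in> elems H" if "(\<Sqinter>i\<in>I. G i) \<le> Fg a"
  proof (rule Inf_chain_filters_le_Fg[OF _ _ that])
    show "H \<le> H' \<or> H' \<le> H" if "H \<in> G ` I" "H' \<in> G ` I" for H H'
      using that tr' transposes_up_mono by fastforce
  qed (use ne in simp)
  ultimately have "\<not> (\<Sqinter>i\<in>I. G i) \<le> Fg a" by blast
  then have "\<not> (\<Sqinter>i\<in>I. G i) \<le> F i0" using a by (meson le_Fg_iff order_trans)
  then show "(\<Sqinter>i\<in>I. F i) \<prec> (\<Sqinter>i\<in>I. G i)"
    using Inf_chain_covering[OF r i0] FG tr i0 by blast
qed

theorem theorem16: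
  fixes x y :: "'a::{complete_modular_lattice, meet_continuous_lattice}"
  assumes "x \<prec> y" and "regular x y"
  shows "Fg x \<prec> Fg y \<and> regular (Fg x) (Fg y)"
  using assms Fg_covering upper_regular_Fg lower_regular_fil unfolding regular_def by blast

end
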